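(* Let $s(z)$ be a (scalar) rational inner function of degree $n\ge1$ with Schur parameters $s_0,s_1,\dots,s_n$, and let $U^0=\|u^0_{j,k}\|_{0\le j,k\le n}$ be the special lower Hessenberg unitary $(n+1)\times(n+1)$ matrix whose associated unitary colligation is minimal and which represents $s(z)$. Put $\Delta_j=(1-|s_j|^2)^{1/2}$. Then $$u^0_{j,k}=\begin{cases}s_0,& j=0,\ k=0,\\ s_j\,\Delta_{j-1}\Delta_{j-2}\cdots\Delta_1\Delta_0,& 1\le j\le n,\ k=0,\\ -s_j\,\Delta_{j-1}\Delta_{j-2}\cdots\Delta_k\,\overline{s_{k-1}},& 1\le j\le n,\ 1\le k\le j,\\ \Delta_j,& 0\le j\le n-1,\ k=j+1,\\ 0,& 0\le j<n-1,\ j+1<k\le n,\end{cases}$$ where for $k=j$ the empty product $\Delta_{j-1}\cdots\Delta_k$ equals $1$.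
   Context: A scalar rational inner function is a rational function, holomorphic in $\{|z|<1\}$, of modulus $\le1$ there and of modulus $1$ on $\{|z|=1\}$; its degree is the maximum of the degrees of numerator and denominator in lowest terms. Schur parameters: for $s$ rational inner of degree $n$, put $s_0(z)=s(z)$ and $$s_{k+1}(z)=\frac1z\,\frac{s_k(z)-s_k}{1-s_k(z)\overline{s_k}},\qquad s_k=s_k(0),\quad k=0,\dots,n-1;$$ here $|s_k|<1$ for $k<n$ and $s_n(z)\equiv s_n$ with $|s_n|=1$. The numbers $s_0,\dots,s_n$ are the Schur parameters of $s$. A unitary $(n+1)\times(n+1)$ matrix $U=\begin{bmatrix}A&B\\ C&D\end{bmatrix}$ ($A$ of size $1\times1$, $D$ of size $n\times n$) represents $s$ if $s(z)=A+zB(I_n-zD)^{-1}C$; its associated unitary colligation is minimal if both $[C\ \ DC\ \cdots\ D^{n-1}C]$ and $[B^*\ \ D^*B^*\ \cdots\ (D^* )^{n-1}B^*]$ have rank $n$. A square matrix $H=\|h_{jk}\|_{0\le j,k\le n}$ is lower Hessenberg if $h_{jk}=0$ whenever $k>j+1$, and special if in addition $h_{j,j+1}\ge0$ for $0\le j\le n-1$. Among all unitary $(n+1)\times(n+1)$ matrices representing $s$ there is exactly one special lower Hessenberg matrix. *)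

theory Defs
  imports
    "HOL-Complex_Analysis.Complex_Analysis"
    "Jordan_Normal_Form.Schur_Decomposition"
    "Jordan_Normal_Form.DL_Rank"
begin

text \<open>A rational function is a total function on the complex plane; since division by zero
  yields \<^term>\<open>0::complex\<close>, it takes the value zero at its poles.\<close>

definition rational_of_degree :: "nat \<Rightarrow> (complex \<Rightarrow> complex) \<Rightarrow> bool" where
  "rational_of_degree n s \<longleftrightarrow>
     (\<exists>p q. q \<noteq> 0 \<and> coprime p q \<and> n = max (degree p) (degree q) \<and>
            (\<forall>z. s z = poly p z / poly q z))"

definition rational_inner :: "nat \<Rightarrow> (complex \<Rightarrow> complex) \<Rightarrow> bool" where
  "rational_inner n s \<longleftrightarrow>
     rational_of_degree n s \<and>
     s holomorphic_on {z. norm z < 1} \<and>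
     (\<forall>z. norm z < 1 \<longrightarrow> norm (s z) \<le> 1) \<and>
     (\<forall>z. norm z = 1 \<longrightarrow> norm (s z) = 1)"

text \<open>The right-hand side of the Schur recursion is \<open>0 / 0\<close> at the origin;
  \<^const>\<open>remove_sings\<close> replaces its value there (and at any other removable
  singularity) by the limit.\<close>

fun schur_fun :: "(complex \<Rightarrow> complex) \<Rightarrow> nat \<Rightarrow> complex \<Rightarrow> complex" where
  "schur_fun s 0 = s"
| "schur_fun s (Suc k) =
     remove_sings (\<lambda>z. 1 / z * ((schur_fun s k z - schur_fun s k 0) /
                                (1 - schur_fun s k z * cnj (schur_fun s k 0))))"

definition schur_param :: "(complex \<Rightarrow> complex) \<Rightarrow> nat \<Rightarrow> complex" where
  "schur_param s k = schur_fun s k 0"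

definition schur_defect :: "(complex \<Rightarrow> complex) \<Rightarrow> nat \<Rightarrow> real" where
  "schur_defect s k = sqrt (1 - (norm (schur_param s k))\<^sup>2)"

definition unitary_mat :: "complex mat \<Rightarrow> bool" where
  "unitary_mat U \<longleftrightarrow>
     square_mat U \<and> inverts_mat U (mat_adjoint U) \<and> inverts_mat (mat_adjoint U) U"

text \<open>Here \<open>R\<close> is the inverse of \<open>I - z D\<close>. Its existence for \<open>norm z < 1\<close> is no
  restriction when \<open>U\<close> is unitary, because \<open>D\<close> is then a contraction.\<close>

definition represents :: "nat \<Rightarrow> complex mat \<Rightarrow> (complex \<Rightarrow> complex) \<Rightarrow> bool" where
  "represents n U s \<longleftrightarrow>
     (case split_block U 1 1 of (A, B, C, D) \<Rightarrow>
        \<forall>z. norm z < 1 \<longrightarrow>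
          (\<exists>R \<in> carrier_mat n n.
             inverts_mat (1\<^sub>m n - z \<cdot>\<^sub>m D) R \<and> inverts_mat R (1\<^sub>m n - z \<cdot>\<^sub>m D) \<and>
             s z = (A + z \<cdot>\<^sub>m (B * R * C)) $$ (0, 0)))"

definition krylov_mat :: "nat \<Rightarrow> complex mat \<Rightarrow> complex mat \<Rightarrow> complex mat" where
  "krylov_mat n D C = mat_of_cols n (map (\<lambda>k. col (D ^\<^sub>m k * C) 0) [0..<n])"

definition minimal_colligation :: "nat \<Rightarrow> complex mat \<Rightarrow> bool" where
  "minimal_colligation n U \<longleftrightarrow>
     (case split_block U 1 1 of (A, B, C, D) \<Rightarrow>
        vec_space.rank n (krylov_mat n D C) = n \<and>
        vec_space.rank n (krylov_mat n (mat_adjoint D) (mat_adjoint B)) = n)"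

definition lower_hessenberg :: "complex mat \<Rightarrow> bool" where
  "lower_hessenberg H \<longleftrightarrow>
     (\<forall>j < dim_row H. \<forall>k < dim_col H. k > j + 1 \<longrightarrow> H $$ (j, k) = 0)"

definition special_lower_hessenberg :: "complex mat \<Rightarrow> bool" where
  "special_lower_hessenberg H \<longleftrightarrow>
     lower_hessenberg H \<and>
     (\<forall>j. j + 1 < dim_row H \<longrightarrow> H $$ (j, j + 1) \<in> \<real> \<and> Re (H $$ (j, j + 1)) \<ge> 0)"

end

theory Submission
  imports Defs
begin

text \<open>
  The proof peels off one Schur parameter at a time. Let \<open>U\<close> be a special lower Hessenberg unitary
  matrix realizing \<open>f\<close>, with positive superdiagonal. Its first row is
  \<open>(s\<^sub>0, \<Delta>\<^sub>0, 0, \<dots>, 0)\<close>, because the value at the origin is \<open>f 0 = s\<^sub>0\<close> and the row has norm one.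
  Orthogonality of the rows then forces
  \<open>U = (1 \<oplus> U') (G \<oplus> I)\<close>, where \<open>G\<close> is the \<open>2 \<times> 2\<close> unitary matrix with rows
  \<open>(s\<^sub>0, \<Delta>\<^sub>0)\<close> and \<open>(\<Delta>\<^sub>0, - cnj s\<^sub>0)\<close>, and \<open>U'\<close> is again unitary and special lower
  Hessenberg with positive superdiagonal (\<open>peel_sum\<close>, \<open>sh_unitary_peel\<close>).

  The transfer function of \<open>U\<close> at \<open>z\<close> is described by a state vector: \<open>U\<close> maps
  \<open>(1, z x\<^sub>1, \<dots>, z x\<^sub>n)\<close> to \<open>(f z, x\<^sub>1, \<dots>, x\<^sub>n)\<close>. Dividing the last \<open>n\<close> of these equations by
  \<open>w = \<Delta>\<^sub>0 - cnj s\<^sub>0 z x\<^sub>1 = (1 - f z cnj s\<^sub>0) / \<Delta>\<^sub>0\<close> turns them into the same description for \<open>U'\<close>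
  with first output \<open>x\<^sub>1 / w\<close>, which is the Schur quotient of \<open>f\<close>
  (\<open>realizes_schur_quot\<close>). As \<open>U'\<close> is an isometry, its states stay bounded near the origin, so the
  singularity of the Schur quotient there is removed by the value \<open>U'\<^sub>0\<^sub>0\<close>
  (\<open>schur_quot_tendsto_0\<close>). Hence \<open>U'\<close> realizes the next Schur function, and the formula follows by
  induction on the size (\<open>hessenberg_entries\<close>).

  Minimality enters only through positivity of the superdiagonal: if the entry \<open>(j, j + 1)\<close> of \<open>U\<close>
  vanished, every vector \<open>(D\<^sup>*)\<^sup>k B\<^sup>*\<close> would vanish from coordinate \<open>j\<close> on, and these vectors could
  not span (\<open>minimal_superdiagonal_nonzero\<close>).
\<close>

section \<open>Unitary Hessenberg matrices and their transfer functions\<close>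

text \<open>The matrix with entries \<open>U j k\<close>, \<open>j, k \<le> n\<close>, is lower Hessenberg with positive
  superdiagonal and is unitary. Entries are a function of natural-number indices, so that rows and
  columns can be dropped without changing type. Unitarity is stated twice, as orthonormality of the
  rows and as preservation of the norm; either form determines the other, and both are used.\<close>

definition sh_unitary :: "nat \<Rightarrow> (nat \<Rightarrow> nat \<Rightarrow> complex) \<Rightarrow> bool" where
  "sh_unitary n U \<longleftrightarrow>
     (\<forall>i\<le>n. \<forall>j\<le>n. (\<Sum>k\<le>n. U i k * cnj (U j k)) = (if i = j then 1 else 0)) \<and>
     (\<forall>v. (\<Sum>j\<le>n. (cmod (\<Sum>k\<le>n. U j k * v k))\<^sup>2) = (\<Sum>k\<le>n. (cmod (v k))\<^sup>2)) \<and>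
     (\<forall>j\<le>n. \<forall>k\<le>n. j + 1 < k \<longrightarrow> U j k = 0) \<and>
     (\<forall>j<n. U j (Suc j) \<in> \<real> \<and> Re (U j (Suc j)) > 0)"

text \<open>The matrix \<open>U\<close> realizes \<open>f\<close> on the unit disc, in state-space form. In the block notation
  \<open>U = [A B; C D]\<close> the components \<open>x 1, \<dots>, x n\<close> are the state \<open>(I - z D)\<^sup>-\<^sup>1 C\<close>; the output
  \<open>f z = A + z B (I - z D)\<^sup>-\<^sup>1 C\<close> is kept as component \<open>x 0\<close>, so that all rows of \<open>U\<close> are treated
  alike.\<close>

definition realizes :: "nat \<Rightarrow> (nat \<Rightarrow> nat \<Rightarrow> complex) \<Rightarrow> (complex \<Rightarrow> complex) \<Rightarrow> bool" where
  "realizes n U f \<longleftrightarrow>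
     (\<forall>z. cmod z < 1 \<longrightarrow>
        (\<exists>x. x 0 = f z \<and>
             (\<forall>j\<le>n. (\<Sum>k\<le>n. U j k * (if k = 0 then 1 else z * x k)) = x j)))"

lemma sh_unitaryD:
  assumes "sh_unitary n U"
  shows sh_unitary_rows:
      "i \<le> n \<Longrightarrow> j \<le> n \<Longrightarrow> (\<Sum>k\<le>n. U i k * cnj (U j k)) = (if i = j then 1 else 0)"
    and sh_unitary_isometry:
      "(\<Sum>j\<le>n. (cmod (\<Sum>k\<le>n. U j k * v k))\<^sup>2) = (\<Sum>k\<le>n. (cmod (v k))\<^sup>2)"
    and sh_unitary_hessenberg: "j \<le> n \<Longrightarrow> k \<le> n \<Longrightarrow> j + 1 < k \<Longrightarrow> U j k = 0"
    and sh_unitary_superdiag: "j < n \<Longrightarrow> U j (Suc j) \<in> \<real>" "j < n \<Longrightarrow> Re (U j (Suc j)) > 0"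
  using assms unfolding sh_unitary_def by auto

lemma realizesD:
  assumes "realizes n U f" and "cmod z < 1"
  shows "\<exists>x. x 0 = f z \<and> (\<forall>j\<le>n. (\<Sum>k\<le>n. U j k * (if k = 0 then 1 else z * x k)) = x j)"
  using assms unfolding realizes_def by simp

text \<open>Both bounds come from the energy balance
  \<open>|x 0|\<^sup>2 + (1 - |z|\<^sup>2) (|x 1|\<^sup>2 + \<dots> + |x n|\<^sup>2) = 1\<close>, which says that \<open>U\<close> preserves the norm.\<close>

lemma realizes_bounds:
  assumes U: "sh_unitary n U" and z: "cmod z < 1"
    and x: "\<And>j. j \<le> n \<Longrightarrow> (\<Sum>k\<le>n. U j k * (if k = 0 then 1 else z * x k)) = x j"
  shows "cmod (x 0) \<le> 1"
    and "\<And>k. 1 \<le> k \<Longrightarrow> k \<le> n \<Longrightarrow> (1 - (cmod z)\<^sup>2) * (cmod (x k))\<^sup>2 \<le> 1"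
proof -
  define S where "S = (\<Sum>i<n. (cmod (x (Suc i)))\<^sup>2)"
  have "(\<Sum>j\<le>n. (cmod (x j))\<^sup>2)
      = (\<Sum>j\<le>n. (cmod (\<Sum>k\<le>n. U j k * (if k = 0 then 1 else z * x k)))\<^sup>2)"
    by (intro sum.cong) (auto simp: x)
  also have "\<dots> = (\<Sum>k\<le>n. (cmod (if k = 0 then 1 else z * x k))\<^sup>2)"
    by (rule sh_unitary_isometry[OF U])
  finally have "(cmod (x 0))\<^sup>2 + S = 1 + (cmod z)\<^sup>2 * S"
    by (simp add: sum.atMost_shift S_def norm_mult power_mult_distrib sum_distrib_left)
  then have energy: "(cmod (x 0))\<^sup>2 + (1 - (cmod z)\<^sup>2) * S = 1"
    by (simp add: algebra_simps)
  have S0: "S \<ge> 0"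
    unfolding S_def by (intro sum_nonneg) auto
  have z1: "1 - (cmod z)\<^sup>2 > 0"
    using z by (simp add: power_less_one_iff abs_square_less_1)
  have "(cmod (x 0))\<^sup>2 \<le> 1"
    using energy mult_nonneg_nonneg[OF less_imp_le[OF z1] S0] by linarith
  then show "cmod (x 0) \<le> 1"
    by (simp add: power_le_one_iff)
  fix k assume k: "1 \<le> k" "k \<le> n"
  then obtain i where i: "k = Suc i" "i < n"
    by (cases k) auto
  have "(cmod (x k))\<^sup>2 \<le> S"
    unfolding S_def i(1)
    by (rule member_le_sum[of i "{..<n}" "\<lambda>i. (cmod (x (Suc i)))\<^sup>2"]) (use i in auto)
  then have "(1 - (cmod z)\<^sup>2) * (cmod (x k))\<^sup>2 \<le> (1 - (cmod z)\<^sup>2) * S"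
    using z1 by (intro mult_left_mono) auto
  also have "\<dots> \<le> 1"
    using energy zero_le_power2[of "cmod (x 0)"] by linarith
  finally show "(1 - (cmod z)\<^sup>2) * (cmod (x k))\<^sup>2 \<le> 1" .
qed

section \<open>Peeling off the first elementary rotation\<close>

lemma sum_atMost_Suc_split2:
  "(\<Sum>k\<le>Suc n. g k) = g 0 + g 1 + (\<Sum>i<n. g (Suc (Suc i)))"
  for g :: "nat \<Rightarrow> 'a :: comm_monoid_add"
  by (subst sum.atMost_Suc_shift, subst sum.atMost_shift) (simp add: add.assoc)

text \<open>The lower right factor \<open>U'\<close> in \<open>U = (1 \<oplus> U') (G \<oplus> I)\<close>. Since \<open>G\<close> acts on the first two
  coordinates only, \<open>U'\<close> agrees with \<open>U\<close> from the third column of \<open>U\<close> on, and its first column is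
  read off from the first column of \<open>U\<close>.\<close>

definition peel :: "(nat \<Rightarrow> nat \<Rightarrow> complex) \<Rightarrow> nat \<Rightarrow> nat \<Rightarrow> complex" where
  "peel U j k = (if k = 0 then U (Suc j) 0 / U 0 1 else U (Suc j) (Suc k))"

lemma peel_Suc: "peel U j (Suc k) = U (Suc j) (Suc (Suc k))"
  by (simp add: peel_def)

context
  fixes n :: nat and U :: "nat \<Rightarrow> nat \<Rightarrow> complex"
  assumes U: "sh_unitary (Suc n) U"
begin

lemma first_row:
  shows "U 0 1 = of_real (sqrt (1 - (cmod (U 0 0))\<^sup>2))"
    and "(cmod (U 0 0))\<^sup>2 < 1"
    and "U 0 1 \<noteq> 0"
    and "cnj (U 0 1) = U 0 1"
    and "U 0 0 * cnj (U 0 0) + U 0 1 * U 0 1 = 1"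
proof -
  define d where "d = Re (U 0 1)"
  have "U 0 1 \<in> \<real>" and d0: "d > 0"
    using sh_unitary_superdiag[OF U, of 0] by (simp_all add: d_def)
  then have d: "U 0 (Suc 0) = of_real d"
    by (simp add: d_def of_real_Re)
  have "(\<Sum>k\<le>Suc n. U 0 k * cnj (U 0 k)) = 1"
    using sh_unitary_rows[OF U, of 0 0] by simp
  moreover have "U 0 (Suc (Suc i)) = 0" if "i < n" for i
    using sh_unitary_hessenberg[OF U] that by simp
  ultimately have *: "U 0 0 * cnj (U 0 0) + U 0 1 * cnj (U 0 1) = 1"
    unfolding sum_atMost_Suc_split2 by simp
  then have "complex_of_real ((cmod (U 0 0))\<^sup>2 + d\<^sup>2) = of_real 1"
    by (simp only: of_real_add complex_norm_square) (simp add: d power2_eq_square)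
  then have "(cmod (U 0 0))\<^sup>2 + d\<^sup>2 = 1"
    using of_real_eq_iff by blast
  then have d2: "1 - (cmod (U 0 0))\<^sup>2 = d\<^sup>2"
    by simp
  show "U 0 1 = of_real (sqrt (1 - (cmod (U 0 0))\<^sup>2))"
    using d0 by (simp add: d2 d)
  show "(cmod (U 0 0))\<^sup>2 < 1"
    using d2 d0 by (smt (verit) zero_less_power)
  show "U 0 1 \<noteq> 0" "cnj (U 0 1) = U 0 1"
    using d0 by (auto simp: d)
  then show "U 0 0 * cnj (U 0 0) + U 0 1 * U 0 1 = 1"
    using * by simp
qed

lemma peel_col_0:
  "U (Suc j) 0 = peel U j 0 * U 0 1"
  using first_row(3) by (simp add: peel_def)

lemma peel_col_1:
  assumes "j \<le> n"
  shows "U (Suc j) 1 = - peel U j 0 * cnj (U 0 0)"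
proof -
  have "(\<Sum>k\<le>Suc n. U (Suc j) k * cnj (U 0 k)) = 0"
    using sh_unitary_rows[OF U, of "Suc j" 0] assms by simp
  moreover have "U 0 (Suc (Suc i)) = 0" if "i < n" for i
    using sh_unitary_hessenberg[OF U] that by simp
  ultimately have "U (Suc j) 0 * cnj (U 0 0) + U (Suc j) 1 * U 0 1 = 0"
    unfolding sum_atMost_Suc_split2 by (simp add: first_row(4)[simplified])
  then have "U 0 1 * (U (Suc j) 1 + peel U j 0 * cnj (U 0 0)) = 0"
    unfolding peel_col_0 by (simp add: algebra_simps)
  then show ?thesis
    using first_row(3) by (simp add: eq_neg_iff_add_eq_0)
qed

text \<open>This is the factorization \<open>U = (1 \<oplus> U') (G \<oplus> I)\<close>, applied to a vector and read off in all
  rows but the first.\<close>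

lemma peel_sum:
  assumes "j \<le> n"
  shows "(\<Sum>k\<le>Suc n. U (Suc j) k * v k)
       = peel U j 0 * (U 0 1 * v 0 - cnj (U 0 0) * v 1) + (\<Sum>i<n. peel U j (Suc i) * v (Suc (Suc i)))"
proof -
  have "(\<Sum>i<n. U (Suc j) (Suc (Suc i)) * v (Suc (Suc i)))
      = (\<Sum>i<n. peel U j (Suc i) * v (Suc (Suc i)))"
    by (simp add: peel_def)
  then show ?thesis
    unfolding sum_atMost_Suc_split2 peel_col_1[OF assms] peel_col_0
    by (simp add: algebra_simps)
qed

lemma sh_unitary_peel: "sh_unitary n (peel U)"
  unfolding sh_unitary_def
proof (intro conjI allI impI)
  fix i j assume ij: "i \<le> n" "j \<le> n"
  have "(\<Sum>k\<le>n. peel U i k * cnj (peel U j k))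
      = peel U i 0 * cnj (peel U j 0) * (U 0 0 * cnj (U 0 0) + U 0 1 * U 0 1)
        + (\<Sum>k<n. peel U i (Suc k) * cnj (peel U j (Suc k)))"
    unfolding first_row(5) by (simp add: sum.atMost_shift)
  also have "\<dots> = (\<Sum>k\<le>Suc n. U (Suc i) k * cnj (U (Suc j) k))"
    unfolding sum_atMost_Suc_split2 peel_col_1[OF ij(1)] peel_col_1[OF ij(2)] peel_col_0
    by (simp add: peel_Suc first_row(4)[simplified] algebra_simps)
  also have "\<dots> = (if i = j then 1 else 0)"
    using sh_unitary_rows[OF U, of "Suc i" "Suc j"] ij by simp
  finally show "(\<Sum>k\<le>n. peel U i k * cnj (peel U j k)) = (if i = j then 1 else 0)" .
next
  fix v :: "nat \<Rightarrow> complex"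
  \<comment> \<open>The preimage of \<open>(0, v)\<close> under \<open>G \<oplus> I\<close>: its image under \<open>U\<close> is \<open>(0, U' v)\<close>.\<close>
  define w where "w k = (if k = 0 then U 0 1 * v 0 else if k = 1 then - U 0 0 * v 0 else v (k - 1))"
    for k
  have w: "w 0 = U 0 1 * v 0" "w 1 = - U 0 0 * v 0" "w (Suc (Suc i)) = v (Suc i)" for i
    by (simp_all add: w_def)
  have row0: "(\<Sum>k\<le>Suc n. U 0 k * w k) = 0"
  proof -
    have "U 0 (Suc (Suc i)) = 0" if "i < n" for i
      using sh_unitary_hessenberg[OF U] that by simp
    then show ?thesis
      unfolding sum_atMost_Suc_split2 w by simp
  qed
  have row: "(\<Sum>k\<le>Suc n. U (Suc j) k * w k) = (\<Sum>k\<le>n. peel U j k * v k)" if "j \<le> n" for j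
  proof -
    have "U 0 1 * w 0 - cnj (U 0 0) * w 1 = (U 0 0 * cnj (U 0 0) + U 0 1 * U 0 1) * v 0"
      unfolding w by (simp add: algebra_simps)
    then have "U 0 1 * w 0 - cnj (U 0 0) * w 1 = v 0"
      unfolding first_row(5) by simp
    then show ?thesis
      unfolding peel_sum[OF that] by (simp add: w sum.atMost_shift)
  qed
  have "(\<Sum>j\<le>n. (cmod (\<Sum>k\<le>n. peel U j k * v k))\<^sup>2)
      = (\<Sum>j\<le>n. (cmod (\<Sum>k\<le>Suc n. U (Suc j) k * w k))\<^sup>2)"
    by (intro sum.cong refl) (metis row atMost_iff)
  also have "\<dots> = (\<Sum>j\<le>Suc n. (cmod (\<Sum>k\<le>Suc n. U j k * w k))\<^sup>2)"
    by (subst (3) sum.atMost_Suc_shift) (simp only: row0, simp)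
  also have "\<dots> = (\<Sum>k\<le>Suc n. (cmod (w k))\<^sup>2)"
    by (rule sh_unitary_isometry[OF U])
  also have "\<dots> = (\<Sum>k\<le>n. (cmod (v k))\<^sup>2)"
  proof -
    have "complex_of_real ((cmod (U 0 1 * v 0))\<^sup>2 + (cmod (- U 0 0 * v 0))\<^sup>2)
        = (U 0 0 * cnj (U 0 0) + U 0 1 * U 0 1) * of_real ((cmod (v 0))\<^sup>2)"
      unfolding of_real_add complex_norm_square
      by (simp add: first_row(4)[simplified] algebra_simps)
    then have "(cmod (U 0 1 * v 0))\<^sup>2 + (cmod (- U 0 0 * v 0))\<^sup>2 = (cmod (v 0))\<^sup>2"
      unfolding first_row(5) by (metis mult_1 of_real_eq_iff)
    then show ?thesis
      unfolding sum_atMost_Suc_split2 w by (simp add: sum.atMost_shift)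
  qed
  finally show "(\<Sum>j\<le>n. (cmod (\<Sum>k\<le>n. peel U j k * v k))\<^sup>2) = (\<Sum>k\<le>n. (cmod (v k))\<^sup>2)" .
next
  fix j k assume "j \<le> n" "k \<le> n" "j + 1 < k"
  then show "peel U j k = 0"
    using sh_unitary_hessenberg[OF U, of "Suc j" "Suc k"] by (auto simp: peel_def)
next
  fix j assume "j < n"
  then show "peel U j (Suc j) \<in> \<real>" "Re (peel U j (Suc j)) > 0"
    using sh_unitary_superdiag[OF U, of "Suc j"] by (simp_all add: peel_def)
qed

end

section \<open>One step of the Schur algorithm\<close>

lemma realizes_at_0:
  assumes "realizes n U f"
  shows "f 0 = U 0 0"
proof -
  obtain x where "x 0 = f 0"
    and "\<forall>j\<le>n. (\<Sum>k\<le>n. U j k * (if k = 0 then 1 else 0 * x k)) = x j"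
    using realizesD[OF assms, of 0] by auto
  then have "(\<Sum>k\<le>n. U 0 k * (if k = 0 then 1 else 0 * x k)) = f 0"
    by (metis le0)
  then show ?thesis
    by (simp add: sum.atMost_shift)
qed

text \<open>The right-hand side of the Schur recursion before its removable singularities are filled in;
  at the origin it takes the default value \<open>0\<close> of a division by zero.\<close>

definition schur_quot :: "(complex \<Rightarrow> complex) \<Rightarrow> complex \<Rightarrow> complex" where
  "schur_quot f z = 1 / z * ((f z - f 0) / (1 - f z * cnj (f 0)))"

text \<open>Away from the origin the peeled matrix realizes the Schur quotient: its states are those of
  \<open>U\<close>, shifted by one and renormalized so that the first input is one.\<close>

lemma realizes_schur_quot:
  assumes U: "sh_unitary (Suc n) U" and f: "realizes (Suc n) U f"
    and z: "cmod z < 1" "z \<noteq> 0"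
  shows "\<exists>y. y 0 = schur_quot f z \<and>
           (\<forall>j\<le>n. (\<Sum>k\<le>n. peel U j k * (if k = 0 then 1 else z * y k)) = y j)"
    and "1 - f z * cnj (f 0) \<noteq> 0"
proof -
  obtain x where x0: "x 0 = f z"
    and "\<forall>j\<le>Suc n. (\<Sum>k\<le>Suc n. U j k * (if k = 0 then 1 else z * x k)) = x j"
    using realizesD[OF f z(1)] by blast
  note x = this(2)[rule_format]
  define a d where "a = U 0 0" and "d = U 0 1"
  have f0: "f 0 = a"
    using realizes_at_0[OF f] by (simp add: a_def)
  have d0: "d \<noteq> 0" and ad: "a * cnj a + d * d = 1" and a1: "(cmod a)\<^sup>2 < 1"
    using first_row[OF U] by (simp_all add: a_def d_def)
  have "cmod (f z) \<le> 1"
    using realizes_bounds(1)[OF U z(1) x] x0 by simp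
  moreover have "cmod a < 1"
    using a1 by (simp add: power_less_one_iff abs_square_less_1)
  ultimately have "cmod (f z * cnj a) < 1"
    by (smt (verit) complex_mod_cnj mult_left_le_one_le norm_ge_zero norm_mult)
  then show nz: "1 - f z * cnj (f 0) \<noteq> 0"
    unfolding f0 by auto
  have "U 0 (Suc (Suc i)) = 0" if "i < n" for i
    using sh_unitary_hessenberg[OF U] that by simp
  then have fz: "f z = a + d * (z * x 1)"
    using x[of 0] unfolding sum_atMost_Suc_split2 by (simp add: x0 a_def d_def)
  \<comment> \<open>The second component of \<open>G (1, z x\<^sub>1)\<close>, that is, the first input of \<open>U'\<close>.\<close>
  define w where "w = d - cnj a * (z * x 1)"
  have dw: "d * w = 1 - f z * cnj a"
  proof -
    have "1 - f z * cnj a = (a * cnj a + d * d) - f z * cnj a"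
      by (simp only: ad)
    then show ?thesis
      unfolding fz w_def by (simp add: algebra_simps)
  qed
  then have w0: "w \<noteq> 0"
    using nz f0 by auto
  define y where "y j = x (Suc j) / w" for j
  have "y 0 = (d * (z * x 1)) / (z * (d * w))"
    using d0 z by (simp add: y_def)
  also have "\<dots> = schur_quot f z"
    unfolding dw schur_quot_def f0 using fz by simp
  finally have y0: "y 0 = schur_quot f z" .
  have "(\<Sum>k\<le>n. peel U j k * (if k = 0 then 1 else z * y k)) = y j" if j: "j \<le> n" for j
  proof -
    have "x (Suc j) = peel U j 0 * w + (\<Sum>i<n. peel U j (Suc i) * (z * x (Suc (Suc i))))"
      using x[of "Suc j"] j unfolding peel_sum[OF U j] by (simp add: w_def a_def d_def)
    also have "\<dots> = w * (\<Sum>k\<le>n. peel U j k * (if k = 0 then 1 else z * y k))"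
      using w0 by (simp add: sum.atMost_shift y_def sum_distrib_left algebra_simps)
    finally show ?thesis
      using w0 by (simp add: y_def)
  qed
  with y0 show "\<exists>y. y 0 = schur_quot f z \<and>
           (\<forall>j\<le>n. (\<Sum>k\<le>n. peel U j k * (if k = 0 then 1 else z * y k)) = y j)"
    by blast
qed

lemma schur_quot_tendsto_0:
  assumes U: "sh_unitary (Suc n) U" and f: "realizes (Suc n) U f"
  shows "schur_quot f \<midarrow>0\<rightarrow> peel U 0 0"
proof -
  have U': "sh_unitary n (peel U)"
    by (rule sh_unitary_peel[OF U])
  \<comment> \<open>Only the state \<open>y 1\<close> enters the output row, and its norm is at most \<open>2\<close> for \<open>|z| < 1/2\<close>.\<close>
  have bound: "cmod (schur_quot f z - peel U 0 0) \<le> cmod z * (2 * cmod (peel U 0 1))"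
    if z: "z \<noteq> 0" "cmod z < 1/2" for z
  proof -
    obtain y where y0: "y 0 = schur_quot f z"
      and y: "\<And>j. j \<le> n \<Longrightarrow> (\<Sum>k\<le>n. peel U j k * (if k = 0 then 1 else z * y k)) = y j"
      using realizes_schur_quot(1)[OF U f, of z] z by auto
    show ?thesis
    proof (cases n)
      case 0
      then show ?thesis
        using y[of 0] y0 by simp
    next
      case (Suc m)
      have "peel U 0 (Suc (Suc i)) = 0" if "i < m" for i
        using sh_unitary_hessenberg[OF U'] that Suc by simp
      then have "schur_quot f z = peel U 0 0 + peel U 0 1 * (z * y 1)"
        using y[of 0] unfolding Suc sum_atMost_Suc_split2 by (simp add: y0)
      then have eq: "cmod (schur_quot f z - peel U 0 0) = cmod z * (cmod (y 1) * cmod (peel U 0 1))"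
        by (simp add: norm_mult)
      have "(1 - (cmod z)\<^sup>2) * (cmod (y 1))\<^sup>2 \<le> 1"
        using realizes_bounds(2)[OF U' _ y, of 1] z Suc by simp
      moreover have "(cmod z)\<^sup>2 \<le> (1/2)\<^sup>2"
        using z by (intro power_mono) auto
      then have "1/4 * (cmod (y 1))\<^sup>2 \<le> (1 - (cmod z)\<^sup>2) * (cmod (y 1))\<^sup>2"
        by (intro mult_right_mono) (auto simp: power2_eq_square)
      ultimately have "(cmod (y 1))\<^sup>2 \<le> 2\<^sup>2"
        by simp
      then have "cmod (y 1) \<le> 2"
        by (rule power2_le_imp_le) simp
      then show ?thesis
        unfolding eq by (intro mult_left_mono mult_right_mono) auto
    qed
  qed
  have "eventually (\<lambda>z. norm (schur_quot f z - peel U 0 0) \<le> cmod z * (2 * cmod (peel U 0 1))) (at 0)"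
    unfolding eventually_at by (rule exI[of _ "1/2"]) (use bound in \<open>auto simp: dist_norm\<close>)
  moreover have "((\<lambda>z. cmod z * (2 * cmod (peel U 0 1))) \<longlongrightarrow> 0) (at 0)"
    by (auto intro!: tendsto_eq_intros)
  ultimately have "((\<lambda>z. schur_quot f z - peel U 0 0) \<longlongrightarrow> 0) (at 0)"
    by (rule Lim_null_comparison)
  then show ?thesis
    by (simp add: LIM_zero_iff)
qed

text \<open>Continuity off the origin is carried along because \<^const>\<open>remove_sings\<close> takes limits: it leaves
  the value of a function unchanged at a point where the function is continuous.\<close>

lemma schur_step:
  assumes U: "sh_unitary (Suc n) U" and f: "realizes (Suc n) U f"
    and cont: "continuous_on (ball 0 1 - {0}) f"
  shows "realizes n (peel U) (schur_fun f 1)"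
    and "continuous_on (ball 0 1 - {0}) (schur_fun f 1)"
proof -
  have g: "schur_fun f 1 = remove_sings (schur_quot f)"
    by (simp add: schur_quot_def[abs_def])
  have "continuous_on (ball 0 1 - {0}) (schur_quot f)"
    unfolding schur_quot_def[abs_def]
    using realizes_schur_quot(2)[OF U f] by (intro continuous_intros cont) auto
  then have contq: "isCont (schur_quot f) z" if "z \<in> ball 0 1 - {0}" for z
    using that by (simp add: continuous_on_eq_continuous_at open_Diff)
  have eq: "remove_sings (schur_quot f) z = schur_quot f z" if "z \<in> ball 0 1 - {0}" for z
    using contq[OF that] by (intro remove_sings_eqI) (simp add: isCont_def)
  show "continuous_on (ball 0 1 - {0}) (schur_fun f 1)"
    unfolding g using \<open>continuous_on _ (schur_quot f)\<close> by (subst continuous_on_cong[OF refl eq]) auto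
  have at_0: "remove_sings (schur_quot f) 0 = peel U 0 0"
    by (intro remove_sings_eqI schur_quot_tendsto_0[OF U f])
  show "realizes n (peel U) (schur_fun f 1)"
    unfolding realizes_def
  proof (intro allI impI)
    fix z :: complex assume z: "cmod z < 1"
    show "\<exists>x. x 0 = schur_fun f 1 z \<and>
            (\<forall>j\<le>n. (\<Sum>k\<le>n. peel U j k * (if k = 0 then 1 else z * x k)) = x j)"
    proof (cases "z = 0")
      case True
      show ?thesis
        unfolding g True at_0
        by (rule exI[of _ "\<lambda>j. peel U j 0"]) (simp add: sum.atMost_shift)
    next
      case False
      then show ?thesis
        using realizes_schur_quot(1)[OF U f z] eq[of z] z unfolding g by simp
    qed
  qed
qed

section \<open>The entries by induction\<close>

text \<open>The recursion defining \<^const>\<open>schur_fun\<close> adds a step at the end; the induction on the size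
  of the matrix removes one at the beginning.\<close>

lemma schur_fun_Suc_shift: "schur_fun s (Suc k) = schur_fun (schur_fun s 1) k"
proof (induction k)
  case (Suc k)
  show ?case
    by (simp only: schur_fun.simps(2)[of s "Suc k"] Suc schur_fun.simps(2)[of "schur_fun s 1" k])
qed simp

lemma schur_param_Suc_shift: "schur_param s (Suc k) = schur_param (schur_fun s 1) k"
  unfolding schur_param_def by (simp only: schur_fun_Suc_shift)

lemma schur_defect_Suc_shift: "schur_defect s (Suc k) = schur_defect (schur_fun s 1) k"
  unfolding schur_defect_def by (simp only: schur_param_Suc_shift)

lemma prod_schur_defect_shift:
  "(\<Prod>i\<in>{Suc k..<Suc j}. schur_defect s i) = (\<Prod>i\<in>{k..<j}. schur_defect (schur_fun s 1) i)"
  unfolding prod.shift_bounds_Suc_ivl schur_defect_Suc_shift ..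

lemma hessenberg_entries:
  assumes "sh_unitary n U" and "realizes n U f" and "continuous_on (ball 0 1 - {0}) f"
  shows "(\<forall>j\<le>n. U j 0 = schur_param f j * of_real (\<Prod>i\<in>{0..<j}. schur_defect f i))
    \<and> (\<forall>j k. 1 \<le> k \<and> k \<le> j \<and> j \<le> n \<longrightarrow>
         U j k = - schur_param f j * of_real (\<Prod>i\<in>{k..<j}. schur_defect f i)
                 * cnj (schur_param f (k - 1)))
    \<and> (\<forall>j<n. U j (Suc j) = of_real (schur_defect f j))"
  using assms
proof (induction n arbitrary: U f)
  case 0
  then show ?case
    using realizes_at_0[of 0 U f] by (simp add: schur_param_def)
next
  case (Suc n)
  note U = Suc.prems(1) and f = Suc.prems(2)
  let ?g = "schur_fun f 1"
  have "sh_unitary n (peel U)" "realizes n (peel U) ?g" "continuous_on (ball 0 1 - {0}) ?g"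
    using sh_unitary_peel[OF U] schur_step[OF Suc.prems] by blast+
  note IH = Suc.IH[OF this]
  have s0: "U 0 0 = schur_param f 0"
    using realizes_at_0[OF f] by (simp add: schur_param_def)
  have d0: "U 0 1 = of_real (schur_defect f 0)"
    using first_row(1)[OF U] by (simp add: s0 schur_defect_def)
  have col0: "peel U j 0 = schur_param f (Suc j) * of_real (\<Prod>i\<in>{1..<Suc j}. schur_defect f i)"
    if "j \<le> n" for j
    using IH that unfolding One_nat_def prod_schur_defect_shift schur_param_Suc_shift by simp
  show ?case
  proof (intro conjI allI impI)
    fix j assume j: "j \<le> Suc n"
    show "U j 0 = schur_param f j * of_real (\<Prod>i\<in>{0..<j}. schur_defect f i)"
    proof (cases j)
      case (Suc i)
      then show ?thesis
        using j col0[of i] peel_col_0[OF U, of i]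
        by (simp add: d0[simplified] prod.atLeast_Suc_lessThan[of 0] del: prod.op_ivl_Suc)
    qed (simp add: s0)
  next
    fix j k assume jk: "1 \<le> k \<and> k \<le> j \<and> j \<le> Suc n"
    then obtain j' k' where [simp]: "j = Suc j'" "k = Suc k'"
      by (metis Suc_le_D One_nat_def le_trans)
    show "U j k = - schur_param f j * of_real (\<Prod>i\<in>{k..<j}. schur_defect f i)
                  * cnj (schur_param f (k - 1))"
    proof (cases k')
      case 0
      then show ?thesis
        using jk peel_col_1[OF U, of j'] col0[of j'] by (simp add: s0)
    next
      case (Suc m)
      have "U j k = peel U j' k'"
        by (simp add: peel_def Suc)
      also have "\<dots> = - schur_param ?g j' * of_real (\<Prod>i\<in>{k'..<j'}. schur_defect ?g i)
                  * cnj (schur_param ?g (k' - 1))"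
        using IH jk Suc by simp
      finally show ?thesis
        by (simp only: \<open>j = Suc j'\<close> \<open>k = Suc k'\<close> prod_schur_defect_shift schur_param_Suc_shift
            Suc diff_Suc_1)
    qed
  next
    fix j assume j: "j < Suc n"
    show "U j (Suc j) = of_real (schur_defect f j)"
    proof (cases j)
      case (Suc i)
      then have "peel U i (Suc i) = of_real (schur_defect ?g i)"
        using IH j by simp
      then show ?thesis
        by (simp only: Suc schur_defect_Suc_shift) (simp add: peel_def)
    qed (use d0 in simp)
  qed
qed

section \<open>Passage from matrices to entry functions\<close>

lemma mat_adjoint_dim [simp]:
  "dim_row (mat_adjoint A) = dim_col A" "dim_col (mat_adjoint A) = dim_row A"
  by (simp_all add: mat_adjoint_def)

lemma mat_adjoint_index [simp]:
  "i < dim_col A \<Longrightarrow> j < dim_row A \<Longrightarrow> mat_adjoint A $$ (i, j) = conjugate (A $$ (j, i))"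
  by (simp add: mat_adjoint_def mat_of_rows_index)

lemma unitary_mat_rows:
  assumes U: "U \<in> carrier_mat m m" "unitary_mat U" and ij: "i < m" "j < m"
  shows "(\<Sum>k<m. U $$ (i, k) * cnj (U $$ (j, k))) = (if i = j then 1 else 0)"
proof -
  have "U * mat_adjoint U = 1\<^sub>m m"
    using U by (auto simp: unitary_mat_def inverts_mat_def)
  then have "(U * mat_adjoint U) $$ (i, j) = (if i = j then 1 else 0)"
    using ij by simp
  then show ?thesis
    using U ij by (simp add: scalar_prod_def atLeast0LessThan)
qed

lemma unitary_mat_cols:
  assumes U: "U \<in> carrier_mat m m" "unitary_mat U" and ij: "i < m" "j < m"
  shows "(\<Sum>k<m. cnj (U $$ (k, i)) * U $$ (k, j)) = (if i = j then 1 else 0)"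
proof -
  have "mat_adjoint U * U = 1\<^sub>m m"
    using U by (auto simp: unitary_mat_def inverts_mat_def)
  then have "(mat_adjoint U * U) $$ (i, j) = (if i = j then 1 else 0)"
    using ij by simp
  then show ?thesis
    using U ij by (simp add: scalar_prod_def atLeast0LessThan)
qed

lemma unitary_mat_isometry:
  assumes U: "U \<in> carrier_mat m m" "unitary_mat U"
  shows "(\<Sum>j<m. (cmod (\<Sum>k<m. U $$ (j, k) * v k))\<^sup>2) = (\<Sum>k<m. (cmod (v k))\<^sup>2)"
proof -
  have "complex_of_real (\<Sum>j<m. (cmod (\<Sum>k<m. U $$ (j, k) * v k))\<^sup>2)
      = (\<Sum>j<m. (\<Sum>l<m. U $$ (j, l) * v l) * cnj (\<Sum>k<m. U $$ (j, k) * v k))"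
    by (simp only: of_real_sum complex_norm_square)
  also have "\<dots> = (\<Sum>j<m. \<Sum>l<m. \<Sum>k<m. cnj (v k) * v l * (cnj (U $$ (j, k)) * U $$ (j, l)))"
    by (simp add: sum_product algebra_simps)
  also have "\<dots> = (\<Sum>l<m. \<Sum>k<m. \<Sum>j<m. cnj (v k) * v l * (cnj (U $$ (j, k)) * U $$ (j, l)))"
    by (rule trans[OF sum.swap], rule sum.cong[OF refl], rule sum.swap)
  also have "\<dots> = (\<Sum>l<m. \<Sum>k<m. if k = l then cnj (v k) * v l else 0)"
    by (intro sum.cong refl) (simp add: sum_distrib_left[symmetric] unitary_mat_cols[OF U])
  also have "\<dots> = (\<Sum>l<m. v l * cnj (v l))"
    by (simp add: mult.commute)
  also have "\<dots> = complex_of_real (\<Sum>k<m. (cmod (v k))\<^sup>2)"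
    by (simp only: of_real_sum complex_norm_square)
  finally show ?thesis
    using of_real_eq_iff by blast
qed

lemma minimal_superdiagonal_nonzero:
  assumes U: "U \<in> carrier_mat (n + 1) (n + 1)" and hess: "lower_hessenberg U"
    and min: "minimal_colligation n U" and j: "j < n"
  shows "U $$ (j, j + 1) \<noteq> 0"
proof
  assume zero: "U $$ (j, j + 1) = 0"
  \<comment> \<open>Indices of \<open>B\<close> and \<open>D\<close> start at zero, so coordinate \<open>i\<close> of the state is index \<open>i + 1\<close> of \<open>U\<close>.\<close>
  define B where "B = mat 1 n (\<lambda>(i, k). U $$ (i, k + 1))"
  define D where "D = mat n n (\<lambda>(i, k). U $$ (i + 1, k + 1))"
  define K where "K = krylov_mat n (mat_adjoint D) (mat_adjoint B)"
  have h: "U $$ (i, k) = 0" if "i \<le> n" "k \<le> n" "i + 1 < k" for i k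
    using hess U that unfolding lower_hessenberg_def by auto
  have dim_D: "dim_row D = n" "dim_col D = n"
    and D_entry: "\<And>i k. i < n \<Longrightarrow> k < n \<Longrightarrow> D $$ (i, k) = U $$ (i + 1, k + 1)"
    by (simp_all add: D_def)
  have dims: "dim_row (mat_adjoint D) = n" "dim_col (mat_adjoint D) = n"
    "dim_row (mat_adjoint B) = n" "dim_col (mat_adjoint B) = 1"
    by (simp_all add: B_def D_def)
  then have carr: "mat_adjoint D \<in> carrier_mat n n" "mat_adjoint B \<in> carrier_mat n 1"
    by auto
  \<comment> \<open>Vectors vanishing from coordinate \<open>j\<close> on form a subspace invariant under \<open>D\<^sup>*\<close>.\<close>
  have step: "(mat_adjoint D * X) $$ (i, 0) = 0"
    if X: "X \<in> carrier_mat n 1" "\<And>l. j \<le> l \<Longrightarrow> l < n \<Longrightarrow> X $$ (l, 0) = 0"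
      and i: "j \<le> i" "i < n" for X i
  proof -
    have summand: "cnj (U $$ (l + 1, i + 1)) * X $$ (l, 0) = 0" if l: "l < n" for l
    proof (cases "j \<le> l")
      case True
      then show ?thesis using X(2) l by simp
    next
      case False
      then have "l + 1 < i \<or> i = j \<and> l + 1 = j"
        using i by auto
      then have "U $$ (l + 1, i + 1) = 0"
        using h[of "l + 1" "i + 1"] zero i l by auto
      then show ?thesis by simp
    qed
    have "(mat_adjoint D * X) $$ (i, 0) = (\<Sum>l<n. cnj (U $$ (l + 1, i + 1)) * X $$ (l, 0))"
      using X(1) i dim_D by (simp add: scalar_prod_def atLeast0LessThan D_entry)
    also have "\<dots> = 0"
      by (rule sum.neutral) (use summand in auto)
    finally show ?thesis .
  qed
  have vanish: "(mat_adjoint D ^\<^sub>m k * X) $$ (i, 0) = 0"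
    if "X \<in> carrier_mat n 1" "\<And>l. j \<le> l \<Longrightarrow> l < n \<Longrightarrow> X $$ (l, 0) = 0" "j \<le> i" "i < n" for X i k
    using that
  proof (induction k arbitrary: X)
    case 0
    then show ?case by (simp add: dim_D)
  next
    case (Suc k)
    have "mat_adjoint D ^\<^sub>m Suc k * X = mat_adjoint D ^\<^sub>m k * (mat_adjoint D * X)"
      using carr Suc.prems(1) by (simp add: assoc_mult_mat[of _ n n _ n _ 1])
    moreover have "mat_adjoint D * X \<in> carrier_mat n 1"
      using carr Suc.prems(1) by simp
    ultimately show ?case
      using Suc.IH step[OF Suc.prems(1,2)] Suc.prems(3,4) by simp
  qed
  have "mat_adjoint B $$ (l, 0) = 0" if l: "j \<le> l" "l < n" for l
  proof -
    have "U $$ (0, l + 1) = 0"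
      using h[of 0 "l + 1"] zero l by (cases "l = 0") auto
    then show ?thesis
      using l by (simp add: B_def)
  qed
  note vanish = vanish[OF carr(2) this]
  have K: "K \<in> carrier_mat n n"
    by (simp add: K_def krylov_mat_def mat_of_cols_def)
  have "K $$ (j, k) = 0" if "k < n" for k
  proof -
    have "mat_adjoint D ^\<^sub>m k \<in> carrier_mat n n"
      using carr(1) by (rule pow_carrier_mat)
    then have "col (mat_adjoint D ^\<^sub>m k * mat_adjoint B) 0 $ j = 0"
      using vanish[of j k] j dims by (subst index_col) auto
    then show ?thesis
      using that j by (simp add: K_def krylov_mat_def mat_of_cols_index)
  qed
  then have "det K = 0"
    using laplace_expansion_row[OF K j] by simp
  moreover have "vec_space.rank n K = n"
    using min U unfolding minimal_colligation_def split_block_def K_def B_def D_def by (simp add: Let_def)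
  ultimately show False
    using vec_space.det_rank_iff[OF K] by simp
qed

lemma represents_realizes:
  assumes U: "U \<in> carrier_mat (n + 1) (n + 1)" and s: "represents n U s"
  shows "realizes n (\<lambda>j k. U $$ (j, k)) s"
  unfolding realizes_def
proof (intro allI impI)
  fix z :: complex assume z: "cmod z < 1"
  define A where "A = mat 1 1 (\<lambda>ij. U $$ ij)"
  define B where "B = mat 1 n (\<lambda>(i, k). U $$ (i, k + 1))"
  define C where "C = mat n 1 (\<lambda>(i, k). U $$ (i + 1, k))"
  define D where "D = mat n n (\<lambda>(i, k). U $$ (i + 1, k + 1))"
  note defs = A_def B_def C_def D_def
  have ABCD: "A \<in> carrier_mat 1 1" "B \<in> carrier_mat 1 n" "C \<in> carrier_mat n 1"
    "D \<in> carrier_mat n n"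
    by (simp_all add: defs)
  have "split_block U 1 1 = (A, B, C, D)"
    using U by (simp add: split_block_def defs Let_def)
  then obtain R where R: "R \<in> carrier_mat n n" and inv: "inverts_mat (1\<^sub>m n - z \<cdot>\<^sub>m D) R"
    and sz: "s z = (A + z \<cdot>\<^sub>m (B * R * C)) $$ (0, 0)"
    using s z unfolding represents_def by auto
  define X where "X = R * C"
  have X: "X \<in> carrier_mat n 1"
    using R ABCD by (simp add: X_def)
  define x where "x j = (if j = 0 then s z else X $$ (j - 1, 0))" for j
  have eq: "(1\<^sub>m n - z \<cdot>\<^sub>m D) * X = C"
  proof -
    have M: "1\<^sub>m n - z \<cdot>\<^sub>m D \<in> carrier_mat n n"
      using ABCD by (intro minus_carrier_mat smult_carrier_mat)
    then have "(1\<^sub>m n - z \<cdot>\<^sub>m D) * R = 1\<^sub>m n"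
      using inv by (auto simp: inverts_mat_def)
    then show ?thesis
      unfolding X_def using assoc_mult_mat[OF M R ABCD(3)] ABCD by (metis left_mult_one_mat)
  qed
  have "(\<Sum>k\<le>n. U $$ (j, k) * (if k = 0 then 1 else z * x k)) = x j" if j: "j \<le> n" for j
  proof (cases j)
    case 0
    have "s z = A $$ (0, 0) + z * (B * X) $$ (0, 0)"
      using sz ABCD R X unfolding X_def by (simp add: assoc_mult_mat[OF ABCD(2) R ABCD(3)])
    then show ?thesis
      using X 0
      by (simp add: x_def sum.atMost_shift scalar_prod_def defs atLeast0LessThan sum_distrib_left mult_ac)
  next
    case (Suc i)
    have "((1\<^sub>m n - z \<cdot>\<^sub>m D) * X) $$ (i, 0) = (X - z \<cdot>\<^sub>m (D * X)) $$ (i, 0)"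
      using X ABCD by (simp add: minus_mult_distrib_mat[of _ n n] mult_smult_assoc_mat[of _ n n])
    also have "\<dots> = X $$ (i, 0) - z * (D * X) $$ (i, 0)"
      using X ABCD j Suc by simp
    finally have "X $$ (i, 0) = C $$ (i, 0) + z * (D * X) $$ (i, 0)"
      unfolding eq by simp
    then show ?thesis
      using X j Suc
      by (simp add: x_def sum.atMost_shift scalar_prod_def defs atLeast0LessThan sum_distrib_left mult_ac)
  qed
  then show "\<exists>x. x 0 = s z \<and>
               (\<forall>j\<le>n. (\<Sum>k\<le>n. U $$ (j, k) * (if k = 0 then 1 else z * x k)) = x j)"
    by (intro exI[of _ x]) (simp add: x_def)
qed

theorem mainTheorem7:
  fixes s :: "complex \<Rightarrow> complex" and n :: nat and U :: "complex mat"
  assumes "n \<ge> 1"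
    and "rational_inner n s"
    and "U \<in> carrier_mat (n + 1) (n + 1)"
    and "unitary_mat U"
    and "special_lower_hessenberg U"
    and "minimal_colligation n U"
    and "represents n U s"
  shows "U $$ (0, 0) = schur_param s 0
    \<and> (\<forall>j. 1 \<le> j \<and> j \<le> n \<longrightarrow>
         U $$ (j, 0) = schur_param s j * of_real (\<Prod>i\<in>{0..<j}. schur_defect s i))
    \<and> (\<forall>j k. 1 \<le> j \<and> j \<le> n \<and> 1 \<le> k \<and> k \<le> j \<longrightarrow>
         U $$ (j, k) = - schur_param s j * of_real (\<Prod>i\<in>{k..<j}. schur_defect s i)
                         * cnj (schur_param s (k - 1)))
    \<and> (\<forall>j. j \<le> n - 1 \<longrightarrow> U $$ (j, j + 1) = of_real (schur_defect s j))
    \<and> (\<forall>j k. j < n - 1 \<and> j + 1 < k \<and> k \<le> n \<longrightarrow> U $$ (j, k) = 0)"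
proof -
  define V where "V = (\<lambda>j k. U $$ (j, k))"
  note U = assms(3) and uni = assms(4)
  have hess: "lower_hessenberg U"
    using assms(5) by (simp add: special_lower_hessenberg_def)
  have eq: "{..n} = {..<n + 1}"
    by auto
  have "sh_unitary n V"
    unfolding sh_unitary_def
  proof (intro conjI allI impI)
    show "(\<Sum>k\<le>n. V i k * cnj (V j k)) = (if i = j then 1 else 0)" if "i \<le> n" "j \<le> n" for i j
      using unitary_mat_rows[OF U uni, of i j] that unfolding V_def eq by simp
    show "(\<Sum>j\<le>n. (cmod (\<Sum>k\<le>n. V j k * v k))\<^sup>2) = (\<Sum>k\<le>n. (cmod (v k))\<^sup>2)" for v
      using unitary_mat_isometry[OF U uni] unfolding V_def eq .
    show "V j k = 0" if "j \<le> n" "k \<le> n" "j + 1 < k" for j k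
      using hess U that unfolding lower_hessenberg_def V_def by auto
    show "V j (Suc j) \<in> \<real>" if "j < n" for j
      using assms(5) U that unfolding special_lower_hessenberg_def V_def by auto
    show "0 < Re (V j (Suc j))" if j: "j < n" for j
    proof -
      have "U $$ (j, j + 1) \<in> \<real>" "Re (U $$ (j, j + 1)) \<ge> 0"
        using assms(5) U j unfolding special_lower_hessenberg_def by auto
      with minimal_superdiagonal_nonzero[OF U hess assms(6) j] show ?thesis
        unfolding V_def by (auto simp: complex_eq_iff complex_is_Real_iff)
    qed
  qed
  moreover have "realizes n V s"
    unfolding V_def by (rule represents_realizes[OF U assms(7)])
  moreover have "continuous_on (ball 0 1 - {0}) s"
  proof -
    have "s holomorphic_on ball 0 1"
      using assms(2) by (simp add: rational_inner_def ball_def)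
    then show ?thesis
      using holomorphic_on_imp_continuous_on continuous_on_subset by blast
  qed
  ultimately have E: "(\<forall>j\<le>n. V j 0 = schur_param s j * of_real (\<Prod>i\<in>{0..<j}. schur_defect s i))
    \<and> (\<forall>j k. 1 \<le> k \<and> k \<le> j \<and> j \<le> n \<longrightarrow>
         V j k = - schur_param s j * of_real (\<Prod>i\<in>{k..<j}. schur_defect s i)
                 * cnj (schur_param s (k - 1)))
    \<and> (\<forall>j<n. V j (Suc j) = of_real (schur_defect s j))"
    by (rule hessenberg_entries)
  show ?thesis
  proof (intro conjI allI impI)
    show "U $$ (0, 0) = schur_param s 0"
      using conjunct1[OF E, rule_format, of 0] by (simp add: V_def)
    show "U $$ (j, j + 1) = of_real (schur_defect s j)" if "j \<le> n - 1" for j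
      using E assms(1) that by (simp add: V_def)
    show "U $$ (j, k) = 0" if "j < n - 1 \<and> j + 1 < k \<and> k \<le> n" for j k
      using hess U that unfolding lower_hessenberg_def by auto
  qed (use E in \<open>simp_all add: V_def\<close>)
qed

end
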